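(* Let $T$ and $T'$ be crystallographic tilings of $\mathbb{E}^n$ and let $\gamma \in \mathrm{Isom}(\mathbb{E}^n)$. Then $T$ and $T'$ are $\gamma$-MLD if and only if their automorphism groups are conjugated by $\gamma$, that is, $\gamma \cdot \mathrm{Aut}(T) \cdot \gamma^{-1} = \mathrm{Aut}(T')$.
   Context: $\mathbb{E}^n$ is $n$-dimensional Euclidean space (the points of $\mathbb{R}^n$ with the Euclidean distance), $\mathrm{Isom}(\mathbb{E}^n)$ is its group of isometries with its usual topology, and $B_R(x)$ is the closed ball of radius $R$ around $x$. A convex polytope is the convex hull of finitely many points; a face of an $n$-dimensional convex polytope $P$ is the intersection of $P$ with a supporting hyperplane (the empty set is also admitted as a face). A tiling of $\mathbb{E}^n$ is a set of $n$-dimensional convex polytopes $T=\{t_i\}_{i\in I}$ (the tiles) with $\bigcup_i t_i=\mathbb{E}^n$ such that for all $i\neq j$ the intersection $t_i\cap t_j$ is a face of both $t_i$ and $t_j$. A tiling is simple if there are finitely many convex polytopes (prototiles) such that every tile is the image of one of them under an isometry of $\mathbb{E}^n$. For $\phi\in\mathrm{Isom}(\mathbb{E}^n)$ put $\phi(T)=\{\phi(t_i)\}_{i\in I}$. For a bounded set $A\subset\mathbb{E}^n$, $[T]_A$ denotes the set of all tiles of $T$ that intersect $A$. A crystallographic group is a discrete subgroup $\Gamma\subset\mathrm{Isom}(\mathbb{E}^n)$ such that $\mathrm{Isom}(\mathbb{E}^n)/\Gamma$ is compact. For a simple tiling $T$, $\mathrm{Aut}(T)=\{\phi\in\mathrm{Isom}(\mathbb{E}^n):\phi(T)=T\}$.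 A simple tiling $T$ is crystallographic if $\mathrm{Aut}(T)$ is a crystallographic group. For $\gamma\in\mathrm{Isom}(\mathbb{E}^n)$, a simple tiling $T'$ is $\gamma$-locally derivable ($\gamma$-LD) from a simple tiling $T$ if there exists a real number $R>0$ such that for all $x\in\mathbb{E}^n$ and $\phi\in\mathrm{Isom}(\mathbb{E}^n)$: $[T]_{B_R(x)}=[\phi(T)]_{B_R(x)}$ implies $[T']_{\{\gamma(x)\}}=[\gamma\phi\gamma^{-1}(T')]_{\{\gamma(x)\}}$. $T$ and $T'$ are $\gamma$-MLD (mutually $\gamma$-locally derivable) if $T'$ is $\gamma$-LD from $T$ and $T$ is $\gamma^{-1}$-LD from $T'$. *)

theory Defs
  imports "HOL-Analysis.Analysis" "HOL-Algebra.Left_Coset"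
begin

section \<open>The isometry group and its topology\<close>

definition isom_group :: "('a::euclidean_space \<Rightarrow> 'a) monoid" where
  "isom_group =
     \<lparr>carrier = {f. bij f \<and> (\<forall>x y. dist (f x) (f y) = dist x y)}, mult = (\<circ>), one = id\<rparr>"

abbreviation Isom :: "('a::euclidean_space \<Rightarrow> 'a) set" where
  "Isom \<equiv> carrier isom_group"

text \<open>The topology of the function type is the product topology, so this is the topology of
  pointwise convergence. On the isometries of a Euclidean space it coincides with the compact-open
  topology and with the topology of the product of the translations and the orthogonal group.\<close>

definition isom_topology :: "('a::euclidean_space \<Rightarrow> 'a) topology" where
  "isom_topology = top_of_set Isom"

definition quotient_topology :: "'a topology \<Rightarrow> ('a \<Rightarrow> 'b) \<Rightarrow> 'b topology" where
  "quotient_topology X q =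
     topology (\<lambda>U. U \<subseteq> q ` topspace X \<and> openin X {x \<in> topspace X. q x \<in> U})"

lemma openin_quotient_topology:
  "openin (quotient_topology X q) U \<longleftrightarrow>
     U \<subseteq> q ` topspace X \<and> openin X {x \<in> topspace X. q x \<in> U}"
proof -
  have "istopology (\<lambda>U. U \<subseteq> q ` topspace X \<and> openin X {x \<in> topspace X. q x \<in> U})"
    unfolding istopology_def
  proof (intro conjI allI impI)
    fix S T
    assume S: "S \<subseteq> q ` topspace X \<and> openin X {x \<in> topspace X. q x \<in> S}"
      and T: "T \<subseteq> q ` topspace X \<and> openin X {x \<in> topspace X. q x \<in> T}"
    show "S \<inter> T \<subseteq> q ` topspace X" using S by blast
    have "{x \<in> topspace X. q x \<in> S \<inter> T} =
        {x \<in> topspace X. q x \<in> S} \<inter> {x \<in> topspace X. q x \<in> T}" by blast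
    then show "openin X {x \<in> topspace X. q x \<in> S \<inter> T}" using S T by auto
  next
    fix \<K>
    assume K: "\<forall>K\<in>\<K>. K \<subseteq> q ` topspace X \<and> openin X {x \<in> topspace X. q x \<in> K}"
    show "\<Union>\<K> \<subseteq> q ` topspace X" using K by blast
    have "{x \<in> topspace X. q x \<in> \<Union>\<K>} = (\<Union>K\<in>\<K>. {x \<in> topspace X. q x \<in> K})" by blast
    then show "openin X {x \<in> topspace X. q x \<in> \<Union>\<K>}" using K by auto
  qed
  then show ?thesis by (simp add: quotient_topology_def)
qed

lemma topspace_quotient_topology [simp]:
  "topspace (quotient_topology X q) = q ` topspace X"
proof
  show "topspace (quotient_topology X q) \<subseteq> q ` topspace X"
    using openin_topspace[of "quotient_topology X q"] unfolding openin_quotient_topology by simp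
  have "{x \<in> topspace X. q x \<in> q ` topspace X} = topspace X" by blast
  then have "openin (quotient_topology X q) (q ` topspace X)"
    by (simp add: openin_quotient_topology)
  then show "q ` topspace X \<subseteq> topspace (quotient_topology X q)"
    by (rule openin_subset)
qed

lemma quotient_map_quotient_topology: "quotient_map X (quotient_topology X q) q"
  by (auto simp: quotient_map_def openin_quotient_topology)

text \<open>The points of the quotient are the left cosets of \<open>\<Gamma>\<close>.\<close>

definition isom_quotient :: "('a::euclidean_space \<Rightarrow> 'a) set \<Rightarrow> ('a \<Rightarrow> 'a) set topology" where
  "isom_quotient \<Gamma> = quotient_topology isom_topology (\<lambda>\<phi>. \<phi> <#\<^bsub>isom_group\<^esub> \<Gamma>)"

lemma topspace_isom_quotient: "topspace (isom_quotient \<Gamma>) = lcosets\<^bsub>isom_group\<^esub> \<Gamma>"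
  by (auto simp: isom_quotient_def isom_topology_def LCOSETS_def)

lemma group_isom_group: "group (isom_group :: ('a::euclidean_space \<Rightarrow> 'a) monoid)"
proof (rule groupI)
  fix f :: "'a \<Rightarrow> 'a" assume f: "f \<in> Isom"
  then have b: "bij f" and d: "\<And>x y. dist (f x) (f y) = dist x y"
    by (auto simp: isom_group_def)
  have "dist (inv_into UNIV f x) (inv_into UNIV f y) = dist x y" for x y
    using d[of "inv_into UNIV f x" "inv_into UNIV f y"] b by (simp add: bij_is_surj surj_f_inv_f)
  with b have "inv_into UNIV f \<in> Isom" by (auto simp: isom_group_def bij_imp_bij_inv)
  moreover have "inv_into UNIV f \<circ> f = id" using b by (simp add: bij_is_inj)
  ultimately show "\<exists>g\<in>Isom. g \<otimes>\<^bsub>isom_group\<^esub> f = \<one>\<^bsub>isom_group\<^esub>"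
    by (auto simp: isom_group_def)
qed (simp_all add: isom_group_def bij_comp comp_assoc)

lemma inv_isom_group:
  fixes f :: "'a::euclidean_space \<Rightarrow> 'a"
  assumes "f \<in> Isom"
  shows "inv\<^bsub>isom_group\<^esub> f = inv_into UNIV f"
proof -
  interpret group "isom_group :: ('a \<Rightarrow> 'a) monoid" by (rule group_isom_group)
  have "f \<circ> inv\<^bsub>isom_group\<^esub> f = id"
    using r_inv[OF assms] by (simp add: isom_group_def)
  moreover have "inj f" using assms by (simp add: isom_group_def bij_is_inj)
  ultimately show ?thesis
    by (intro ext) (metis comp_apply id_apply inv_into_f_f UNIV_I)
qed

definition crystallographic_group :: "('a::euclidean_space \<Rightarrow> 'a) set \<Rightarrow> bool" where
  "crystallographic_group \<Gamma> \<longleftrightarrow>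
     subgroup \<Gamma> isom_group \<and>
     subtopology isom_topology \<Gamma> = discrete_topology \<Gamma> \<and>
     compact_space (isom_quotient \<Gamma>)"

section \<open>Tilings\<close>

text \<open>In contrast to \<^const>\<open>face_of\<close> and \<^const>\<open>exposed_face_of\<close>, the polytope itself
  is not one of its faces: only genuine supporting hyperplanes, with \<open>a \<noteq> 0\<close>, are allowed.\<close>

definition polytope_face :: "'a::euclidean_space set \<Rightarrow> 'a set \<Rightarrow> bool" where
  "polytope_face F P \<longleftrightarrow>
     F = {} \<or>
     (\<exists>a b. a \<noteq> 0 \<and> P \<subseteq> {x. a \<bullet> x \<le> b} \<and> P \<inter> {x. a \<bullet> x = b} \<noteq> {} \<and>
            F = P \<inter> {x. a \<bullet> x = b})"

definition tiling :: "'a::euclidean_space set set \<Rightarrow> bool" where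
  "tiling T \<longleftrightarrow>
     (\<forall>t\<in>T. polytope t \<and> aff_dim t = int DIM('a)) \<and>
     \<Union>T = UNIV \<and>
     (\<forall>s\<in>T. \<forall>t\<in>T. s \<noteq> t \<longrightarrow> polytope_face (s \<inter> t) s \<and> polytope_face (s \<inter> t) t)"

definition simple_tiling :: "'a::euclidean_space set set \<Rightarrow> bool" where
  "simple_tiling T \<longleftrightarrow>
     tiling T \<and>
     (\<exists>P. finite P \<and> (\<forall>p\<in>P. polytope p) \<and> (\<forall>t\<in>T. \<exists>p\<in>P. \<exists>\<phi>\<in>Isom. t = \<phi> ` p))"

definition move_tiling :: "('a \<Rightarrow> 'a) \<Rightarrow> 'a set set \<Rightarrow> 'a set set" where
  "move_tiling \<phi> T = (\<lambda>t. \<phi> ` t) ` T"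

definition patch :: "'a set set \<Rightarrow> 'a set \<Rightarrow> 'a set set" where
  "patch T A = {t \<in> T. t \<inter> A \<noteq> {}}"

definition Aut :: "'a::euclidean_space set set \<Rightarrow> ('a \<Rightarrow> 'a) set" where
  "Aut T = {\<phi> \<in> Isom. move_tiling \<phi> T = T}"

definition crystallographic_tiling :: "'a::euclidean_space set set \<Rightarrow> bool" where
  "crystallographic_tiling T \<longleftrightarrow> simple_tiling T \<and> crystallographic_group (Aut T)"

section \<open>Local derivability\<close>

text \<open>\<open>locally_derivable \<gamma> T' T\<close>: the tiling \<open>T'\<close> is \<open>\<gamma>\<close>-locally derivable from \<open>T\<close>.
  Only meaningful for simple tilings and \<open>\<gamma> \<in> Isom\<close>.\<close>

definition locally_derivable ::
    "('a::euclidean_space \<Rightarrow> 'a) \<Rightarrow> 'a set set \<Rightarrow> 'a set set \<Rightarrow> bool" where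
  "locally_derivable \<gamma> T' T \<longleftrightarrow>
     (\<exists>R>0. \<forall>x. \<forall>\<phi>\<in>Isom.
        patch T (cball x R) = patch (move_tiling \<phi> T) (cball x R) \<longrightarrow>
        patch T' {\<gamma> x} =
          patch (move_tiling (\<gamma> \<otimes>\<^bsub>isom_group\<^esub> \<phi> \<otimes>\<^bsub>isom_group\<^esub> inv\<^bsub>isom_group\<^esub> \<gamma>) T') {\<gamma> x})"

definition mutually_locally_derivable ::
    "('a::euclidean_space \<Rightarrow> 'a) \<Rightarrow> 'a set set \<Rightarrow> 'a set set \<Rightarrow> bool" where
  "mutually_locally_derivable \<gamma> T T' \<longleftrightarrow>
     locally_derivable \<gamma> T' T \<and> locally_derivable (inv\<^bsub>isom_group\<^esub> \<gamma>) T T'"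

end

theory Submission
  imports Defs
begin

text \<open>
  Everything rests on a rigidity property (\<open>patch_determines_automorphism\<close>): for a crystallographic
  tiling \<open>T\<close> there is one radius \<open>R\<close> such that an isometry \<open>\<phi>\<close> for which \<open>T\<close> and \<open>\<phi>(T)\<close> have the
  same patch on a single ball of radius \<open>R\<close>, wherever its centre is, must already be an automorphism
  of \<open>T\<close>. Since conversely an automorphism preserves all patches, \<open>T'\<close> is \<open>\<gamma>\<close>-locally derivable from
  \<open>T\<close> exactly if \<open>\<gamma> Aut(T) \<gamma>\<inverse> \<subseteq> Aut(T')\<close> (\<open>locally_derivable_iff\<close>). The same criterion
  for \<open>\<gamma>\<inverse>\<close> is the opposite inclusion, so mutual derivability is equality.

  Rigidity is a finiteness argument. By cocompactness the orbit of the origin under \<open>Aut(T)\<close> comes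
  within some distance \<open>r\<close> of every point (\<open>crystallographic_group_cobounded\<close>), so an automorphism
  moves the centre of the ball into \<open>cball 0 r\<close>. Fix a tile \<open>t\<^sub>0\<close> containing the origin. If the
  patches agree, then \<open>t\<^sub>0\<close> is a tile of \<open>\<phi>(T)\<close>, that is, \<open>\<phi>\<close> maps some tile onto \<open>t\<^sub>0\<close>; after
  composing \<open>\<phi>\<close> with an automorphism this tile meets \<open>cball 0 r\<close>. There are only finitely many such
  tiles (\<open>simple_tiling_locally_finite\<close>), and only finitely many isometries map a given
  full-dimensional polytope onto another, because an isometry is determined by its values at the
  vertices (\<open>finite_isometries_between_polytopes\<close>). So, modulo automorphisms, only finitely many
  \<open>\<phi>\<close> have to be excluded, and each one that is not an automorphism is excluded by some finite
  radius.
\<close>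

section \<open>Isometries as affine maps\<close>

abbreviation inv_map :: "('a \<Rightarrow> 'b) \<Rightarrow> 'b \<Rightarrow> 'a" where
  "inv_map f \<equiv> inv_into UNIV f"

lemma mult_isom_group [simp]: "f \<otimes>\<^bsub>isom_group\<^esub> g = f \<circ> g"
  by (simp add: isom_group_def)

lemma isom_bij: "f \<in> Isom \<Longrightarrow> bij f"
  by (simp add: isom_group_def)

lemma isom_dist: "f \<in> Isom \<Longrightarrow> dist (f x) (f y) = dist x y"
  by (simp add: isom_group_def)

lemma isom_comp: "f \<in> Isom \<Longrightarrow> g \<in> Isom \<Longrightarrow> f \<circ> g \<in> Isom"
  using group.is_monoid[OF group_isom_group] monoid.m_closed by fastforce

lemma isom_inv: "f \<in> Isom \<Longrightarrow> inv_map f \<in> Isom"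
  using group.inv_closed[OF group_isom_group] inv_isom_group by metis

lemma isom_image_ball:
  assumes "f \<in> Isom"
  shows "f ` ball x r = ball (f x) r"
proof -
  have "y \<in> f ` ball x r" if "dist (f x) y < r" for y
    using that isom_dist[OF assms] bij_pointE[OF isom_bij[OF assms], of y]
    by (metis image_eqI mem_ball)
  then show ?thesis using isom_dist[OF assms] by auto
qed

lemma isom_image_cball:
  assumes "f \<in> Isom"
  shows "f ` cball x r = cball (f x) r"
proof -
  have "y \<in> f ` cball x r" if "dist (f x) y \<le> r" for y
    using that isom_dist[OF assms] bij_pointE[OF isom_bij[OF assms], of y]
    by (metis image_eqI mem_cball)
  then show ?thesis using isom_dist[OF assms] by auto
qed

lemma isom_affine:
  assumes "f \<in> Isom" and "u + v = 1"
  shows "f (u *\<^sub>R x + v *\<^sub>R y) = u *\<^sub>R f x + v *\<^sub>R f y"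
proof -
  define L where "L = (\<lambda>x. f x - f 0)"
  have "linear L" unfolding L_def
    by (rule isometry_linear) (use isom_dist[OF assms(1)] in \<open>auto simp: dist_norm\<close>)
  then have "L (u *\<^sub>R x + v *\<^sub>R y) = u *\<^sub>R L x + v *\<^sub>R L y"
    by (simp add: linear_add linear_scale)
  then have "f (u *\<^sub>R x + v *\<^sub>R y) - f 0 = u *\<^sub>R (f x - f 0) + v *\<^sub>R (f y - f 0)"
    by (simp add: L_def)
  also have "\<dots> = u *\<^sub>R f x + v *\<^sub>R f y - (u + v) *\<^sub>R f 0"
    by (simp add: algebra_simps)
  finally show ?thesis by (simp add: assms(2))
qed

lemma isom_eq_if_eq_on_affine_span:
  assumes "f \<in> Isom" "g \<in> Isom" and "affine hull V = UNIV" and "\<And>v. v \<in> V \<Longrightarrow> f v = g v"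
  shows "f = g"
proof -
  have "affine {x. f x = g x}"
    by (auto simp: affine_def isom_affine assms)
  then have "affine hull V \<subseteq> {x. f x = g x}"
    using assms(4) by (intro hull_minimal) auto
  then show ?thesis using assms(3) by auto
qed

lemma isom_extreme_point:
  assumes "f \<in> Isom" "v extreme_point_of S"
  shows "f v extreme_point_of (f ` S)"
proof -
  have inj: "inj f" using assms(1) by (simp add: isom_bij bij_is_inj)
  have "f v \<notin> open_segment (f a) (f b)" if "a \<in> S" "b \<in> S" for a b
  proof
    assume "f v \<in> open_segment (f a) (f b)"
    then obtain u where u: "f a \<noteq> f b" "0 < u" "u < 1" "f v = (1 - u) *\<^sub>R f a + u *\<^sub>R f b"
      by (auto simp: in_segment)
    then have "f v = f ((1 - u) *\<^sub>R a + u *\<^sub>R b)"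
      using isom_affine[OF assms(1), of "1 - u" u] by simp
    then have "v = (1 - u) *\<^sub>R a + u *\<^sub>R b" using inj by (simp add: inj_eq)
    then have "v \<in> open_segment a b" using u by (auto simp: in_segment)
    then show False using assms(2) that by (auto simp: extreme_point_of_def)
  qed
  then show ?thesis using assms(2) by (auto simp: extreme_point_of_def)
qed

text \<open>Isometries map vertices to vertices, and the vertices of a full-dimensional polytope span the
  whole space, so such an isometry is a map between two finite sets.\<close>

lemma finite_isometries_between_polytopes:
  fixes s t :: "'a::euclidean_space set"
  assumes "polytope s" "polytope t" "aff_dim s = int DIM('a)"
  shows "finite {f \<in> Isom. f ` s = t}"
proof -
  let ?V = "{v. v extreme_point_of s}" and ?W = "{v. v extreme_point_of t}"
  have fin: "finite ?V" "finite ?W"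
    using assms by (auto intro: finite_polyhedron_extreme_points polytope_imp_polyhedron)
  have "s = convex hull ?V"
    using assms(1) by (intro Krein_Milman_Minkowski polytope_imp_compact polytope_imp_convex)
  then have "affine hull ?V = affine hull s" by (metis affine_hull_convex_hull)
  then have span: "affine hull ?V = UNIV" using assms(3) by (simp add: aff_dim_eq_full)
  have "inj_on (\<lambda>f. restrict f ?V) {f \<in> Isom. f ` s = t}"
  proof (rule inj_onI)
    fix f g assume f: "f \<in> {f \<in> Isom. f ` s = t}" and g: "g \<in> {f \<in> Isom. f ` s = t}"
      and eq: "restrict f ?V = restrict g ?V"
    have "f v = g v" if "v \<in> ?V" for v
      using that eq by (metis restrict_apply')
    then show "f = g" using f g span by (intro isom_eq_if_eq_on_affine_span) auto
  qed
  moreover have "(\<lambda>f. restrict f ?V) ` {f \<in> Isom. f ` s = t} \<subseteq> ?V \<rightarrow>\<^sub>E ?W"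
  proof (intro image_subsetI PiE_I)
    fix f v assume "f \<in> {f \<in> Isom. f ` s = t}" "v \<in> ?V"
    then show "restrict f ?V v \<in> ?W" using isom_extreme_point[of f v s] by simp
  qed simp
  ultimately show ?thesis
    using fin by (meson finite_PiE finite_imageD finite_subset)
qed

section \<open>Local finiteness of simple tilings\<close>

lemma tiling_interior_nonempty:
  fixes T :: "'a::euclidean_space set set"
  assumes "tiling T" "t \<in> T"
  shows "interior t \<noteq> {}"
proof -
  have t: "polytope t" "aff_dim t = int DIM('a)" using assms by (auto simp: tiling_def)
  then have "interior t = rel_interior t"
    by (simp add: rel_interior_interior aff_dim_eq_full)
  moreover have "t \<noteq> {}" using t(2) by auto
  ultimately show ?thesis
    using t(1) by (simp add: rel_interior_eq_empty polytope_imp_convex)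
qed

lemma tiling_empty_notin: "tiling T \<Longrightarrow> {} \<notin> T"
  using tiling_interior_nonempty by fastforce

text \<open>The common face of two tiles lies in a hyperplane, which has no interior.\<close>

lemma tiling_interiors_disjoint:
  assumes "tiling T" "s \<in> T" "t \<in> T" "s \<noteq> t"
  shows "interior s \<inter> interior t = {}"
proof (cases "s \<inter> t = {}")
  case True
  then show ?thesis using interior_subset by blast
next
  case False
  then obtain a b where "a \<noteq> 0" "s \<inter> t \<subseteq> {x. a \<bullet> x = b}"
    using assms unfolding tiling_def polytope_face_def by (metis inf_le2)
  then have "interior (s \<inter> t) = {}"
    by (metis interior_hyperplane interior_mono subset_empty)
  then show ?thesis by (simp add: interior_Int)
qed

text \<open>Replacing each prototile by a tile congruent to it, the prototiles can be taken from the
  tiling itself; so they have an interior.\<close>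

lemma simple_tiling_representatives:
  assumes "simple_tiling T"
  obtains S where "finite S" "S \<subseteq> T" "\<And>t. t \<in> T \<Longrightarrow> \<exists>s\<in>S. \<exists>f\<in>Isom. t = f ` s"
proof -
  obtain P where P: "finite P" "\<And>t. t \<in> T \<Longrightarrow> \<exists>p\<in>P. \<exists>f\<in>Isom. t = f ` p"
    using assms by (auto simp: simple_tiling_def)
  define Q where "Q = {p \<in> P. \<exists>t\<in>T. \<exists>f\<in>Isom. t = f ` p}"
  have "\<forall>p\<in>Q. \<exists>t. t \<in> T \<and> (\<exists>f\<in>Isom. t = f ` p)" by (auto simp: Q_def)
  then obtain h where h: "\<And>p. p \<in> Q \<Longrightarrow> h p \<in> T \<and> (\<exists>f\<in>Isom. h p = f ` p)"
    by metis
  show thesis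
  proof
    show "finite (h ` Q)" using P(1) by (simp add: Q_def)
    show "h ` Q \<subseteq> T" using h by auto
    fix t assume "t \<in> T"
    then obtain p f where p: "p \<in> Q" "f \<in> Isom" "t = f ` p"
      using P(2) by (fastforce simp: Q_def)
    obtain g where g: "g \<in> Isom" "h p = g ` p" using h[OF p(1)] by blast
    have "t = (f \<circ> inv_map g) ` h p"
      using g(2) p(3) image_inv_f_f[OF bij_is_inj[OF isom_bij[OF g(1)]], of p]
      by (metis image_comp)
    moreover have "f \<circ> inv_map g \<in> Isom" using p(2) g(1) by (intro isom_comp isom_inv)
    ultimately show "\<exists>s\<in>h ` Q. \<exists>f\<in>Isom. t = f ` s" using p(1) by (metis imageI)
  qed
qed

text \<open>By finiteness up to congruence, all tiles contain a ball of a common radius \<open>e\<close>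
  and have a common diameter bound \<open>D\<close>. The inscribed balls of different tiles are disjoint, so
  their centres are \<open>e\<close>-separated, and a bounded region contains finitely many of them.\<close>

lemma simple_tiling_locally_finite:
  fixes T :: "'a::euclidean_space set set"
  assumes "simple_tiling T"
  shows "finite (patch T (cball x r))"
proof -
  have til: "tiling T" using assms by (simp add: simple_tiling_def)
  obtain S where S: "finite S" "S \<subseteq> T" "\<And>t. t \<in> T \<Longrightarrow> \<exists>s\<in>S. \<exists>f\<in>Isom. t = f ` s"
    using simple_tiling_representatives[OF assms] by blast
  have "\<exists>e>0. \<exists>c. ball c e \<subseteq> s" if "s \<in> S" for s
    using tiling_interior_nonempty[OF til] that S(2) by (metis ex_in_conv mem_interior subsetD)
  then obtain k where k: "\<And>s. s \<in> S \<Longrightarrow> k s > 0 \<and> (\<exists>c. ball c (k s) \<subseteq> s)"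
    by metis
  define e where "e = Min (insert 1 (k ` S))"
  have e0: "e > 0" using k S(1) by (auto simp: e_def)
  have e_ball: "\<exists>c. ball c e \<subseteq> s" if s: "s \<in> S" for s
  proof -
    obtain c where "ball c (k s) \<subseteq> s" using k s by blast
    moreover have "e \<le> k s" using S(1) s by (auto simp: e_def)
    ultimately show ?thesis using subset_ball by blast
  qed
  have "\<exists>c. ball c e \<subseteq> t" if "t \<in> T" for t
    using S(3)[OF that] e_ball isom_image_ball by (metis image_mono)
  then obtain c where c: "\<And>t. t \<in> T \<Longrightarrow> ball (c t) e \<subseteq> t" by metis
  have sep: "s = t" if "s \<in> T" "t \<in> T" "dist (c s) (c t) < e" for s t
  proof (rule ccontr)
    assume "s \<noteq> t"
    have "c t \<in> ball (c s) e" "c t \<in> ball (c t) e" using that(3) e0 by auto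
    then have "c t \<in> interior s \<inter> interior t"
      using c[OF that(1)] c[OF that(2)] by (meson IntI interiorI open_ball)
    then show False using tiling_interiors_disjoint[OF til that(1,2) \<open>s \<noteq> t\<close>] by blast
  qed
  have "bounded (\<Union>S)"
    using S(1,2) til by (intro bounded_Union ballI polytope_imp_bounded) (auto simp: tiling_def)
  then obtain D where D: "\<And>y z. y \<in> \<Union>S \<Longrightarrow> z \<in> \<Union>S \<Longrightarrow> dist y z \<le> D"
    by (meson diameter_bounded_bound)
  have diam: "dist y z \<le> D" if t: "t \<in> T" "y \<in> t" "z \<in> t" for t y z
    using S(3)[OF t(1)] t(2,3) D isom_dist by (smt (verit) UnionI image_iff)
  have "finite (cball x (r + D) \<inter> c ` T)"
    by (intro finite_not_islimpt_in_compact compact_cball discrete_imp_not_islimpt[OF e0])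
      (use sep in auto)
  moreover have "c ` patch T (cball x r) \<subseteq> cball x (r + D) \<inter> c ` T"
  proof clarify
    fix t assume "t \<in> patch T (cball x r)"
    then obtain y where y: "t \<in> T" "y \<in> t" "dist x y \<le> r" by (auto simp: patch_def)
    have "c t \<in> t" using c[OF y(1)] e0 by auto
    then have "dist y (c t) \<le> D" using diam y by auto
    then show "c t \<in> cball x (r + D) \<inter> c ` T"
      using y dist_triangle[of x "c t" y] by auto
  qed
  moreover have "inj_on c (patch T (cball x r))"
    by (intro inj_onI) (use sep e0 in \<open>auto simp: patch_def\<close>)
  ultimately show ?thesis by (meson finite_imageD finite_subset)
qed

section \<open>Cocompactness\<close>

text \<open>The sets of isometries \<open>\<phi>\<close> that move some point of the orbit of the origin into the
  open ball of radius \<open>k\<close> around the origin are open and unions of left cosets, and they exhaust the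
  isometry group. Since they increase with \<open>k\<close> and the quotient is compact, one of them is the
  whole group. Applied to translations this says that the orbit is \<open>k\<close>-dense.\<close>

lemma crystallographic_group_cobounded:
  fixes \<Gamma> :: "('a::euclidean_space \<Rightarrow> 'a) set"
  assumes "crystallographic_group \<Gamma>"
  obtains r where "r > 0" "\<And>x. \<exists>g\<in>\<Gamma>. dist x (g 0) \<le> r"
proof -
  interpret group "isom_group :: ('a \<Rightarrow> 'a) monoid" by (rule group_isom_group)
  have sub: "subgroup \<Gamma> isom_group" and comp: "compact_space (isom_quotient \<Gamma>)"
    using assms by (auto simp: crystallographic_group_def)
  let ?q = "\<lambda>\<phi>. \<phi> <#\<^bsub>isom_group\<^esub> \<Gamma>"
  define V where "V k = {\<phi> \<in> Isom. \<exists>g\<in>\<Gamma>. norm (\<phi> (g 0)) < real k}" for k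
  have V_mono: "V k \<subseteq> V m" if "k \<le> m" for k m
  proof -
    have "y < real k \<Longrightarrow> y < real m" for y using that by linarith
    then show ?thesis unfolding V_def by blast
  qed
  have V_cover: "\<exists>k. \<phi> \<in> V k" if "\<phi> \<in> Isom" for \<phi>
    using that reals_Archimedean2 subgroup.one_closed[OF sub] by (fastforce simp: V_def)
  have V_saturated: "\<phi> \<in> V k" if V: "\<phi> \<in> Isom" "\<psi> \<in> V k" "?q \<phi> = ?q \<psi>" for \<phi> \<psi> k
  proof -
    obtain g where g: "g \<in> \<Gamma>" "norm (\<psi> (g 0)) < real k" using V(2) by (auto simp: V_def)
    have "\<psi> \<circ> g \<in> ?q \<psi>" using g by (auto simp: l_coset_def)
    then obtain h where "h \<in> \<Gamma>" "\<psi> \<circ> g = \<phi> \<circ> h" using V(3) by (auto simp: l_coset_def)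
    then have "\<psi> (g 0) = \<phi> (h 0)" by (metis comp_apply)
    then show ?thesis using g(2) V(1) \<open>h \<in> \<Gamma>\<close> by (auto simp: V_def)
  qed
  have V_open: "openin isom_topology (V k)" for k
  proof -
    have "open (\<Union>g\<in>\<Gamma>. {\<phi> :: 'a \<Rightarrow> 'a. norm (\<phi> (g 0)) < real k})"
      by (intro open_UN ballI open_Collect_less continuous_intros
          continuous_on_product_coordinates)
    moreover have "V k = Isom \<inter> (\<Union>g\<in>\<Gamma>. {\<phi>. norm (\<phi> (g 0)) < real k})"
      by (auto simp: V_def)
    ultimately show ?thesis unfolding isom_topology_def by (metis openin_open_Int)
  qed
  have "openin (isom_quotient \<Gamma>) (?q ` V k)" for k
  proof -
    have "V k \<subseteq> Isom" by (auto simp: V_def)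
    moreover have top: "topspace isom_topology = (Isom :: ('a \<Rightarrow> 'a) set)"
      by (simp add: isom_topology_def)
    ultimately have preimage: "{\<phi> \<in> topspace isom_topology. ?q \<phi> \<in> ?q ` V k} = V k"
      using V_saturated by blast
    show ?thesis
      unfolding isom_quotient_def openin_quotient_topology preimage
      using V_open[of k] by (intro conjI image_mono openin_subset)
  qed
  moreover have "topspace (isom_quotient \<Gamma>) \<subseteq> \<Union>(range (\<lambda>k. ?q ` V k))"
    using V_cover by (fastforce simp: topspace_isom_quotient LCOSETS_def)
  ultimately obtain \<F> where \<F>: "finite \<F>" "\<F> \<subseteq> range (\<lambda>k. ?q ` V k)"
      "topspace (isom_quotient \<Gamma>) \<subseteq> \<Union>\<F>"
    using comp unfolding compact_space_alt by (metis (no_types, lifting) imageE)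
  obtain K where K: "finite K" "\<F> = (\<lambda>k. ?q ` V k) ` K"
    using finite_subset_image[OF \<F>(1,2)] by blast
  define m where "m = Max (insert 1 K)"
  have m: "1 \<le> m" "\<And>k. k \<in> K \<Longrightarrow> k \<le> m" using K(1) by (auto simp: m_def)
  show thesis
  proof
    show "real m > 0" using m(1) by simp
    fix x :: 'a
    \<comment> \<open>\<open>\<tau>\<close> moves \<open>x\<close> to the origin: orbit points that \<open>\<tau>\<close> brings close to the origin
      are close to \<open>x\<close>.\<close>
    define \<tau> where "\<tau> = (\<lambda>y. y - x)"
    have "bij \<tau>" unfolding \<tau>_def by (rule bij_betwI[where g = "\<lambda>y. y + x"]) auto
    then have \<tau>: "\<tau> \<in> Isom" by (auto simp: isom_group_def \<tau>_def dist_norm)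
    then have "?q \<tau> \<in> topspace (isom_quotient \<Gamma>)"
      by (auto simp: topspace_isom_quotient LCOSETS_def)
    then obtain k \<psi> where "k \<in> K" "\<psi> \<in> V k" "?q \<tau> = ?q \<psi>" using \<F>(3) K(2) by blast
    then have "\<tau> \<in> V m" using V_saturated[OF \<tau>] V_mono m(2) by blast
    then obtain g where "g \<in> \<Gamma>" "norm (g 0 - x) < real m" by (auto simp: V_def \<tau>_def)
    then show "\<exists>g\<in>\<Gamma>. dist x (g 0) \<le> real m"
      by (metis dist_commute dist_norm less_imp_le)
  qed
qed

section \<open>Patches and rigidity\<close>

lemma move_tiling_comp: "move_tiling (f \<circ> g) T = move_tiling f (move_tiling g T)"
  by (simp add: move_tiling_def image_comp comp_def)

lemma empty_notin_move_tiling: "{} \<notin> T \<Longrightarrow> {} \<notin> move_tiling f T"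
  by (simp add: move_tiling_def image_iff)

lemma patch_move_tiling:
  assumes "inj f"
  shows "patch (move_tiling f T) (f ` A) = move_tiling f (patch T A)"
  using assms by (auto simp: patch_def move_tiling_def inj_def)

lemma patch_eq_subset:
  assumes "patch S A = patch T A" "B \<subseteq> A"
  shows "patch S B = patch T B"
  using assms unfolding patch_def by blast

lemma eventually_patch_neq:
  fixes S T :: "'a::real_normed_vector set set"
  assumes "S \<noteq> T" "{} \<notin> S" "{} \<notin> T"
  shows "\<forall>\<^sub>F \<rho> in at_top. patch S (cball 0 \<rho>) \<noteq> patch T (cball 0 \<rho>)"
proof -
  obtain t where t: "t \<in> S \<union> T" "t \<notin> S \<inter> T" using assms(1) by blast
  then obtain p where p: "p \<in> t" using assms(2,3) by (metis UnE ex_in_conv)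
  have "patch S (cball 0 \<rho>) \<noteq> patch T (cball 0 \<rho>)" if "norm p \<le> \<rho>" for \<rho>
  proof -
    have "t \<inter> cball 0 \<rho> \<noteq> {}" using p that by auto
    then show ?thesis using t by (auto simp: patch_def set_eq_iff)
  qed
  then show ?thesis unfolding eventually_at_top_linorder by blast
qed

lemma eq_if_point_patches_eq:
  assumes "{} \<notin> S" "{} \<notin> T" "\<And>y. patch S {y} = patch T {y}"
  shows "S = T"
proof -
  have "t \<in> S \<longleftrightarrow> t \<in> T" if "y \<in> t" for t y
    using assms(3)[of y] that by (auto simp: patch_def set_eq_iff)
  then show ?thesis using assms(1,2) by (metis ex_in_conv subsetI subset_antisym)
qed

text \<open>The radius is \<open>r + M\<close>: the first summand pays for replacing the centre \<open>x\<close> by a point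
  \<open>a 0\<close> of the orbit of the origin, and the second is large enough to tell \<open>T\<close> from \<open>\<theta>(T)\<close> for
  each of the finitely many candidates \<open>\<theta>\<close> that are not automorphisms.\<close>

lemma patch_determines_automorphism:
  fixes T :: "'a::euclidean_space set set"
  assumes "crystallographic_tiling T"
  obtains R where "R > 0"
    "\<And>x \<phi>. \<phi> \<in> Isom \<Longrightarrow> patch T (cball x R) = patch (move_tiling \<phi> T) (cball x R) \<Longrightarrow> \<phi> \<in> Aut T"
proof -
  have simple: "simple_tiling T" and til: "tiling T" and crys: "crystallographic_group (Aut T)"
    using assms by (auto simp: crystallographic_tiling_def simple_tiling_def)
  have sub: "subgroup (Aut T) isom_group" using crys by (simp add: crystallographic_group_def)
  have Aut_comp: "f \<circ> g \<in> Aut T" if "f \<in> Aut T" "g \<in> Aut T" for f g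
    using subgroup.m_closed[OF sub that] by simp
  have Aut_inv: "inv_map f \<in> Aut T" if "f \<in> Aut T" for f
    using subgroup.m_inv_closed[OF sub that] that by (simp add: inv_isom_group Aut_def)
  have AutD: "f \<in> Isom" "move_tiling f T = T" if "f \<in> Aut T" for f
    using that by (auto simp: Aut_def)
  obtain r where r: "r > 0" "\<And>x. \<exists>g\<in>Aut T. dist x (g 0) \<le> r"
    using crystallographic_group_cobounded[OF crys] by blast
  have "\<Union>T = UNIV" using til by (simp add: tiling_def)
  then obtain t0 where t0: "t0 \<in> T" "0 \<in> t0" by (metis UNIV_I UnionE)

  define \<Phi> where "\<Phi> = {\<theta> \<in> Isom. \<exists>s\<in>patch T (cball 0 r). \<theta> ` s = t0}"
  have "\<Phi> = (\<Union>s\<in>patch T (cball 0 r). {\<theta> \<in> Isom. \<theta> ` s = t0})" by (auto simp: \<Phi>_def)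
  moreover have "finite {\<theta> \<in> Isom. \<theta> ` s = t0}" if "s \<in> patch T (cball 0 r)" for s
    using that t0 til
    by (intro finite_isometries_between_polytopes) (auto simp: tiling_def patch_def)
  ultimately have fin: "finite \<Phi>" using simple_tiling_locally_finite[OF simple] by auto
  have "\<forall>\<^sub>F \<rho> in at_top. patch T (cball 0 \<rho>) \<noteq> patch (move_tiling \<theta> T) (cball 0 \<rho>)"
    if "\<theta> \<in> \<Phi> - Aut T" for \<theta>
    using that tiling_empty_notin[OF til]
    by (intro eventually_patch_neq) (auto simp: \<Phi>_def Aut_def move_tiling_def)
  then have "\<forall>\<^sub>F \<rho> in at_top. \<forall>\<theta>\<in>\<Phi> - Aut T.
      patch T (cball 0 \<rho>) \<noteq> patch (move_tiling \<theta> T) (cball 0 \<rho>)"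
    using fin by (intro eventually_ball_finite) auto
  then obtain M0 where M0: "\<And>\<rho> \<theta>. M0 \<le> \<rho> \<Longrightarrow> \<theta> \<in> \<Phi> - Aut T \<Longrightarrow>
      patch T (cball 0 \<rho>) \<noteq> patch (move_tiling \<theta> T) (cball 0 \<rho>)"
    unfolding eventually_at_top_linorder by blast
  define M where "M = max M0 0"
  have M: "0 \<le> M" "\<And>\<theta>. \<theta> \<in> \<Phi> - Aut T \<Longrightarrow>
      patch T (cball 0 M) \<noteq> patch (move_tiling \<theta> T) (cball 0 M)"
    using M0 by (simp_all add: M_def)

  show thesis
  proof
    show "r + M > 0" using r(1) M(1) by simp
    fix x \<phi>
    assume \<phi>: "\<phi> \<in> Isom"
      and eq: "patch T (cball x (r + M)) = patch (move_tiling \<phi> T) (cball x (r + M))"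
    obtain a where a: "a \<in> Aut T" "dist x (a 0) \<le> r" using r(2) by blast
    define \<psi> where "\<psi> = inv_map a \<circ> \<phi>"
    have bij_a: "bij a" using a AutD isom_bij by blast
    have \<psi>: "\<psi> \<in> Isom" unfolding \<psi>_def using a AutD isom_comp isom_inv \<phi> by blast
    have "cball (a 0) M \<subseteq> cball x (r + M)" using a(2) by (simp add: cball_subset_cball_iff dist_commute)
    then have "patch T (cball (a 0) M) = patch (move_tiling \<phi> T) (cball (a 0) M)"
      using eq patch_eq_subset by blast
    moreover have "inv_map a ` cball (a 0) M = cball 0 M"
      using isom_image_cball[OF isom_inv[OF AutD(1)[OF a(1)]]] bij_a by (simp add: bij_is_inj)
    moreover have "inj (inv_map a)" using bij_a by (simp add: bij_imp_bij_inv bij_is_inj)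
    moreover have "move_tiling (inv_map a) T = T" using AutD(2)[OF Aut_inv[OF a(1)]] .
    ultimately have eq0: "patch T (cball 0 M) = patch (move_tiling \<psi> T) (cball 0 M)"
      unfolding \<psi>_def move_tiling_comp by (metis patch_move_tiling)
    have "t0 \<in> patch T (cball 0 M)" using t0 M(1) by (auto simp: patch_def)
    then obtain s where s: "s \<in> T" "t0 = \<psi> ` s" unfolding eq0 by (auto simp: patch_def move_tiling_def)
    then obtain p where p: "p \<in> s" using t0 by blast
    obtain g where g: "g \<in> Aut T" "dist p (g 0) \<le> r" using r(2) by blast
    have bij_g: "bij g" using g AutD isom_bij by blast
    \<comment> \<open>Precomposing \<open>\<psi>\<close> with \<open>g\<close> does not change the image of \<open>T\<close>, but replaces the tile mapped
      onto \<open>t0\<close> by one that meets \<open>cball 0 r\<close>.\<close>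
    have "dist (inv_map g p) 0 = dist p (g 0)"
      using isom_dist[OF AutD(1)[OF g(1)], of "inv_map g p" 0] bij_g by (simp add: bij_is_surj surj_f_inv_f)
    then have "inv_map g p \<in> inv_map g ` s \<inter> cball 0 r" using p g(2) by (auto simp: dist_commute)
    moreover have "inv_map g ` s \<in> T"
      using AutD(2)[OF Aut_inv[OF g(1)]] s(1) by (auto simp: move_tiling_def)
    ultimately have "inv_map g ` s \<in> patch T (cball 0 r)" by (auto simp: patch_def)
    moreover have "(\<psi> \<circ> g) ` (inv_map g ` s) = t0"
      using s(2) image_f_inv_f[OF bij_is_surj[OF bij_g], of s] by (metis image_comp)
    moreover have "\<psi> \<circ> g \<in> Isom" using \<psi> AutD(1)[OF g(1)] by (rule isom_comp)
    ultimately have "\<psi> \<circ> g \<in> \<Phi>" by (auto simp: \<Phi>_def)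
    moreover have "move_tiling (\<psi> \<circ> g) T = move_tiling \<psi> T"
      using AutD(2)[OF g(1)] by (simp add: move_tiling_comp)
    ultimately have "\<psi> \<circ> g \<in> Aut T" using M(2) eq0 by (metis DiffI)
    then have "a \<circ> ((\<psi> \<circ> g) \<circ> inv_map g) \<in> Aut T" using a(1) g(1) Aut_comp Aut_inv by blast
    moreover have "a \<circ> ((\<psi> \<circ> g) \<circ> inv_map g) = \<phi>"
      using bij_a bij_g by (simp add: \<psi>_def fun_eq_iff bij_is_surj surj_f_inv_f)
    ultimately show "\<phi> \<in> Aut T" by simp
  qed
qed

section \<open>Local derivability as inclusion of automorphism groups\<close>

text \<open>An automorphism \<open>\<phi>\<close> of \<open>T\<close> satisfies the premise of local derivability at every point, so
  \<open>T'\<close> and its image under \<open>\<gamma> \<phi> \<gamma>\<inverse>\<close> agree at every point. Conversely, with the radius of the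
  rigidity property the premise
  holds for no other isometry.\<close>

lemma locally_derivable_iff:
  fixes T T' :: "'a::euclidean_space set set"
  assumes "crystallographic_tiling T" "tiling T'" "\<gamma> \<in> Isom"
  shows "locally_derivable \<gamma> T' T \<longleftrightarrow> (\<forall>\<phi>\<in>Aut T. \<gamma> \<circ> \<phi> \<circ> inv_map \<gamma> \<in> Aut T')"
proof
  assume "locally_derivable \<gamma> T' T"
  then obtain R where R: "\<forall>x. \<forall>\<phi>\<in>Isom.
      patch T (cball x R) = patch (move_tiling \<phi> T) (cball x R) \<longrightarrow>
      patch T' {\<gamma> x} = patch (move_tiling (\<gamma> \<circ> \<phi> \<circ> inv_map \<gamma>) T') {\<gamma> x}"
    unfolding locally_derivable_def inv_isom_group[OF assms(3)] mult_isom_group by (elim exE conjE)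
  show "\<forall>\<phi>\<in>Aut T. \<gamma> \<circ> \<phi> \<circ> inv_map \<gamma> \<in> Aut T'"
  proof
    fix \<phi> assume "\<phi> \<in> Aut T"
    then have \<phi>: "\<phi> \<in> Isom" "move_tiling \<phi> T = T" by (auto simp: Aut_def)
    have "patch (move_tiling (\<gamma> \<circ> \<phi> \<circ> inv_map \<gamma>) T') {y} = patch T' {y}" for y
      using bspec[OF spec[OF R, of "inv_map \<gamma> y"] \<phi>(1)] \<phi>(2) isom_bij[OF assms(3)]
      by (simp add: bij_is_surj surj_f_inv_f)
    then have "move_tiling (\<gamma> \<circ> \<phi> \<circ> inv_map \<gamma>) T' = T'"
      using tiling_empty_notin[OF assms(2)] empty_notin_move_tiling
      by (metis eq_if_point_patches_eq)
    moreover have "\<gamma> \<circ> \<phi> \<circ> inv_map \<gamma> \<in> Isom"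
      using \<phi>(1) assms(3) by (intro isom_comp isom_inv)
    ultimately show "\<gamma> \<circ> \<phi> \<circ> inv_map \<gamma> \<in> Aut T'"
      unfolding Aut_def by (intro CollectI conjI)
  qed
next
  assume incl: "\<forall>\<phi>\<in>Aut T. \<gamma> \<circ> \<phi> \<circ> inv_map \<gamma> \<in> Aut T'"
  obtain R where R: "R > 0" "\<And>x \<phi>. \<phi> \<in> Isom \<Longrightarrow>
      patch T (cball x R) = patch (move_tiling \<phi> T) (cball x R) \<Longrightarrow> \<phi> \<in> Aut T"
    using patch_determines_automorphism[OF assms(1)] by blast
  have "patch T' {\<gamma> x} = patch (move_tiling (\<gamma> \<circ> \<phi> \<circ> inv_map \<gamma>) T') {\<gamma> x}"
    if "\<phi> \<in> Isom" "patch T (cball x R) = patch (move_tiling \<phi> T) (cball x R)" for x \<phi>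
    using R(2)[OF that] incl by (simp add: Aut_def)
  then show "locally_derivable \<gamma> T' T"
    unfolding locally_derivable_def inv_isom_group[OF assms(3)] mult_isom_group
    using R(1) by (intro exI[of _ R] conjI allI ballI impI)
qed

theorem theorem0p4:
  fixes T T' :: "(real ^ 'n) set set" and \<gamma> :: "real ^ 'n \<Rightarrow> real ^ 'n"
  assumes "crystallographic_tiling T" and "crystallographic_tiling T'" and "\<gamma> \<in> Isom"
  shows "mutually_locally_derivable \<gamma> T T' \<longleftrightarrow>
    \<gamma> <#\<^bsub>isom_group\<^esub> Aut T #>\<^bsub>isom_group\<^esub> inv\<^bsub>isom_group\<^esub> \<gamma> = Aut T'"
proof -
  have til: "tiling T" "tiling T'"
    using assms by (auto simp: crystallographic_tiling_def simple_tiling_def)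
  have bij: "bij \<gamma>" using assms(3) by (rule isom_bij)
  have conj: "\<gamma> <#\<^bsub>isom_group\<^esub> Aut T #>\<^bsub>isom_group\<^esub> inv\<^bsub>isom_group\<^esub> \<gamma> =
      (\<lambda>\<phi>. \<gamma> \<circ> \<phi> \<circ> inv_map \<gamma>) ` Aut T"
    unfolding l_coset_def r_coset_def inv_isom_group[OF assms(3)] mult_isom_group by blast
  have cancel: "\<gamma> \<circ> (inv_map \<gamma> \<circ> \<phi> \<circ> \<gamma>) \<circ> inv_map \<gamma> = \<phi>" "inv_map \<gamma> \<circ> (\<gamma> \<circ> \<phi> \<circ> inv_map \<gamma>) \<circ> \<gamma> = \<phi>" for \<phi>
    using bij_is_surj[OF bij] bij_is_inj[OF bij] by (simp_all add: fun_eq_iff surj_f_inv_f)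
  have "mutually_locally_derivable \<gamma> T T' \<longleftrightarrow>
      (\<forall>\<phi>\<in>Aut T. \<gamma> \<circ> \<phi> \<circ> inv_map \<gamma> \<in> Aut T') \<and> (\<forall>\<phi>\<in>Aut T'. inv_map \<gamma> \<circ> \<phi> \<circ> \<gamma> \<in> Aut T)"
    unfolding mutually_locally_derivable_def inv_isom_group[OF assms(3)]
      locally_derivable_iff[OF assms(1) til(2) assms(3)]
      locally_derivable_iff[OF assms(2) til(1) isom_inv[OF assms(3)]]
    by (simp add: inv_inv_eq bij)
  also have "\<dots> \<longleftrightarrow> (\<lambda>\<phi>. \<gamma> \<circ> \<phi> \<circ> inv_map \<gamma>) ` Aut T = Aut T'"
  proof
    assume *: "(\<forall>\<phi>\<in>Aut T. \<gamma> \<circ> \<phi> \<circ> inv_map \<gamma> \<in> Aut T') \<and> (\<forall>\<phi>\<in>Aut T'. inv_map \<gamma> \<circ> \<phi> \<circ> \<gamma> \<in> Aut T)"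
    have "\<phi> \<in> (\<lambda>\<phi>. \<gamma> \<circ> \<phi> \<circ> inv_map \<gamma>) ` Aut T" if "\<phi> \<in> Aut T'" for \<phi>
      by (rule image_eqI[OF _ bspec[OF conjunct2[OF *] that]]) (simp only: cancel(1))
    then show "(\<lambda>\<phi>. \<gamma> \<circ> \<phi> \<circ> inv_map \<gamma>) ` Aut T = Aut T'" using * by blast
  next
    assume *: "(\<lambda>\<phi>. \<gamma> \<circ> \<phi> \<circ> inv_map \<gamma>) ` Aut T = Aut T'"
    have "inv_map \<gamma> \<circ> \<phi> \<circ> \<gamma> \<in> Aut T" if "\<phi> \<in> Aut T'" for \<phi>
      using that[folded *] by (elim imageE) (simp only: cancel(2))
    then show "(\<forall>\<phi>\<in>Aut T. \<gamma> \<circ> \<phi> \<circ> inv_map \<gamma> \<in> Aut T') \<and> (\<forall>\<phi>\<in>Aut T'. inv_map \<gamma> \<circ> \<phi> \<circ> \<gamma> \<in> Aut T)"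
      using * by blast
  qed
  finally show ?thesis unfolding conj .
qed

end
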